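(* Let $X$ be a complex Banach space. The following statements hold for every $T\in L(X)$. (i) $T$ satisfies property $(w_{\pi_{00}})$ if and only if $T$ satisfies property $(w)$ and $\sigma_{uf}(T)=\sigma_{uw}(T)$. (ii) $T$ satisfies property $(gw_{\pi_{00}})$ if and only if $T$ satisfies property $(gw)$ and $\sigma_{ubf}(T)=\sigma_{ubw}(T)$.
   Context: $L(X)$ is the algebra of bounded linear operators on the complex Banach space $X$; $N(S)$ and $R(S)$ denote the kernel and range of $S$; $\sigma(T)$ is the spectrum and $\sigma_a(T)$ the approximate point spectrum of $T$; $\mbox{iso}\,A$ is the set of isolated points of $A\subset\mathbb{C}$. $S\in L(X)$ is upper semi-Fredholm if $R(S)$ is closed and $\dim N(S)<\infty$; its index is $\mbox{ind}(S)=\dim N(S)-\mbox{codim}\,R(S)\in\mathbb{Z}\cup\{-\infty\}$. $S$ is upper semi-Weyl if it is upper semi-Fredholm with $\mbox{ind}(S)\le 0$. $S$ is upper semi-B-Fredholm if for some integer $n\ge 0$ the space $R(S^n)$ is closed and the restriction $S_{[n]}:R(S^n)\to R(S^n)$ of $S$ is upper semi-Fredholm; its index is $\mbox{ind}(S):=\mbox{ind}(S_{[n]})$ (independent of the choice of such $n$). $S$ is upper semi-B-Weyl if it is upper semi-B-Fredholm with $\mbox{ind}(S)\le0$. The sets $\sigma_{uf}(T)$, $\sigma_{uw}(T)$, $\sigma_{ubf}(T)$, $\sigma_{ubw}(T)$ consist of the $\lambda\in\mathbb{C}$ such that $T-\lambda I$ is not, respectively, upper semi-Fredholm, upper semi-Weyl,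 upper semi-B-Fredholm, upper semi-B-Weyl. $\sigma_p(T)$ is the set of eigenvalues of $T$, and $\sigma_p^f(T)$ the set of eigenvalues of finite multiplicity ($0<\dim N(T-\lambda I)<\infty$). Put $\pi_0(T)=\mbox{iso}\,\sigma(T)\cap\sigma_p(T)$ and $\pi_{00}(T)=\mbox{iso}\,\sigma(T)\cap\sigma_p^f(T)$. $T$ satisfies: property $(w)$ if $\sigma_a(T)\setminus\sigma_{uw}(T)=\pi_{00}(T)$; property $(gw)$ if $\sigma_a(T)\setminus\sigma_{ubw}(T)=\pi_0(T)$; property $(w_{\pi_{00}})$ if $\sigma_a(T)\setminus\sigma_{uf}(T)=\pi_{00}(T)$; property $(gw_{\pi_{00}})$ if $\sigma_a(T)\setminus\sigma_{ubf}(T)=\pi_0(T)$. *)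

theory Defs
  imports "HOL-Analysis.Analysis"
begin

section \<open>Complex Banach spaces and their bounded operators\<close>

class complex_banach = banach +
  fixes scaleC :: "complex \<Rightarrow> 'a \<Rightarrow> 'a" (infixr \<open>*\<^sub>C\<close> 75)
  assumes scaleC_add_right: "a *\<^sub>C (x + y) = a *\<^sub>C x + a *\<^sub>C y"
    and scaleC_add_left: "(a + b) *\<^sub>C x = a *\<^sub>C x + b *\<^sub>C x"
    and scaleC_scaleC: "a *\<^sub>C b *\<^sub>C x = (a * b) *\<^sub>C x"
    and scaleC_of_real: "complex_of_real r *\<^sub>C x = r *\<^sub>R x"
    and norm_scaleC: "norm (a *\<^sub>C x) = cmod a * norm x"

lemma scaleC_one: "1 *\<^sub>C x = (x :: 'a :: complex_banach)"
  using scaleC_of_real[of 1 x] by simp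

lemma vector_space_scaleC:
  "vector_space (scaleC :: complex \<Rightarrow> 'a :: complex_banach \<Rightarrow> 'a)"
  by unfold_locales (simp_all add: scaleC_add_right scaleC_add_left scaleC_scaleC scaleC_one)

instantiation complex :: complex_banach
begin

definition scaleC_complex :: "complex \<Rightarrow> complex \<Rightarrow> complex" where
  "scaleC_complex a x = a * x"

instance
  by standard (simp_all add: scaleC_complex_def algebra_simps norm_mult scaleR_conv_of_real)

end

definition bounded_clinear :: "('a :: complex_banach \<Rightarrow> 'a) \<Rightarrow> bool" where
  "bounded_clinear T \<longleftrightarrow> bounded_linear T \<and> (\<forall>c x. T (c *\<^sub>C x) = c *\<^sub>C T x)"

definition shift :: "('a :: complex_banach \<Rightarrow> 'a) \<Rightarrow> complex \<Rightarrow> 'a \<Rightarrow> 'a" where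
  "shift T l = (\<lambda>x. T x - l *\<^sub>C x)"

definition kernel_on :: "'a set \<Rightarrow> ('a :: complex_banach \<Rightarrow> 'a) \<Rightarrow> 'a set" where
  "kernel_on V S = {x \<in> V. S x = 0}"


section \<open>Dimension and codimension\<close>

(* The library's dim is 0 on infinite-dimensional spaces; cdim returns infinity there. *)
definition cdim :: "'a :: complex_banach set \<Rightarrow> enat" where
  "cdim V = (if \<exists>B. finite B \<and> V \<subseteq> module.span scaleC B
             then enat (vector_space.dim scaleC V) else \<infinity>)"

(* The cosets b + W, for b in B, are pairwise distinct and form a finite basis of the
   quotient space V / W: a combination of them vanishes in V / W iff the same combination
   of the representatives lies in W. *)
definition finite_quotient_basis ::
  "'a :: complex_banach set \<Rightarrow> 'a set \<Rightarrow> 'a set \<Rightarrow> bool" where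
  "finite_quotient_basis V W B \<longleftrightarrow> finite B \<and> B \<subseteq> V \<and>
     (\<forall>c. (\<Sum>b\<in>B. c b *\<^sub>C b) \<in> W \<longrightarrow> (\<forall>b\<in>B. c b = 0)) \<and>
     (\<forall>v\<in>V. \<exists>c. v - (\<Sum>b\<in>B. c b *\<^sub>C b) \<in> W)"

(* codim V W is the dimension of V / W. *)
definition codim :: "'a :: complex_banach set \<Rightarrow> 'a set \<Rightarrow> enat" where
  "codim V W = (if \<exists>B. finite_quotient_basis V W B
                then enat (card (SOME B. finite_quotient_basis V W B)) else \<infinity>)"


section \<open>Semi-Fredholm and semi-B-Fredholm operators\<close>

(* The _on notions concern the restriction S : V -> V of an operator S to an S-invariant
   subspace V; the operator S on the whole space is the case V = UNIV. *)

definition upper_semi_Fredholm_on ::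
  "'a set \<Rightarrow> ('a :: complex_banach \<Rightarrow> 'a) \<Rightarrow> bool" where
  "upper_semi_Fredholm_on V S \<longleftrightarrow>
     closedin (top_of_set V) (S ` V) \<and> cdim (kernel_on V S) < \<infinity>"

(* Only meaningful for finite-dimensional kernel, where the value is an integer or
   minus infinity; in ereal, infinity - infinity = infinity. *)
definition index_on :: "'a set \<Rightarrow> ('a :: complex_banach \<Rightarrow> 'a) \<Rightarrow> ereal" where
  "index_on V S = ereal_of_enat (cdim (kernel_on V S)) - ereal_of_enat (codim V (S ` V))"

definition upper_semi_Fredholm :: "('a :: complex_banach \<Rightarrow> 'a) \<Rightarrow> bool" where
  "upper_semi_Fredholm S \<longleftrightarrow> upper_semi_Fredholm_on UNIV S"

definition upper_semi_Weyl :: "('a :: complex_banach \<Rightarrow> 'a) \<Rightarrow> bool" where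
  "upper_semi_Weyl S \<longleftrightarrow> upper_semi_Fredholm S \<and> index_on UNIV S \<le> 0"

definition B_Fredholm_exponent :: "('a :: complex_banach \<Rightarrow> 'a) \<Rightarrow> nat \<Rightarrow> bool" where
  "B_Fredholm_exponent S n \<longleftrightarrow>
     closed (range (S ^^ n)) \<and> upper_semi_Fredholm_on (range (S ^^ n)) S"

definition upper_semi_B_Fredholm :: "('a :: complex_banach \<Rightarrow> 'a) \<Rightarrow> bool" where
  "upper_semi_B_Fredholm S \<longleftrightarrow> (\<exists>n. B_Fredholm_exponent S n)"

(* The index of the restriction to range (S ^^ n) does not depend on the admissible n. *)
definition B_index :: "('a :: complex_banach \<Rightarrow> 'a) \<Rightarrow> ereal" where
  "B_index S = index_on (range (S ^^ (SOME n. B_Fredholm_exponent S n))) S"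

definition upper_semi_B_Weyl :: "('a :: complex_banach \<Rightarrow> 'a) \<Rightarrow> bool" where
  "upper_semi_B_Weyl S \<longleftrightarrow> upper_semi_B_Fredholm S \<and> B_index S \<le> 0"


section \<open>Spectra\<close>

definition spectrum :: "('a :: complex_banach \<Rightarrow> 'a) \<Rightarrow> complex set" where
  "spectrum T = {l. \<not> (\<exists>R. bounded_clinear R \<and> shift T l \<circ> R = id \<and> R \<circ> shift T l = id)}"

definition approx_point_spectrum :: "('a :: complex_banach \<Rightarrow> 'a) \<Rightarrow> complex set" where
  "approx_point_spectrum T =
     {l. \<exists>x :: nat \<Rightarrow> 'a. (\<forall>n. norm (x n) = 1) \<and> (\<lambda>n. shift T l (x n)) \<longlonglongrightarrow> 0}"

definition sigma_uf :: "('a :: complex_banach \<Rightarrow> 'a) \<Rightarrow> complex set" where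
  "sigma_uf T = {l. \<not> upper_semi_Fredholm (shift T l)}"

definition sigma_uw :: "('a :: complex_banach \<Rightarrow> 'a) \<Rightarrow> complex set" where
  "sigma_uw T = {l. \<not> upper_semi_Weyl (shift T l)}"

definition sigma_ubf :: "('a :: complex_banach \<Rightarrow> 'a) \<Rightarrow> complex set" where
  "sigma_ubf T = {l. \<not> upper_semi_B_Fredholm (shift T l)}"

definition sigma_ubw :: "('a :: complex_banach \<Rightarrow> 'a) \<Rightarrow> complex set" where
  "sigma_ubw T = {l. \<not> upper_semi_B_Weyl (shift T l)}"

definition eigenvalues :: "('a :: complex_banach \<Rightarrow> 'a) \<Rightarrow> complex set" where
  "eigenvalues T = {l. \<exists>x. x \<noteq> 0 \<and> T x = l *\<^sub>C x}"

definition finite_mult_eigenvalues :: "('a :: complex_banach \<Rightarrow> 'a) \<Rightarrow> complex set" where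
  "finite_mult_eigenvalues T =
     {l. 0 < cdim (kernel_on UNIV (shift T l)) \<and> cdim (kernel_on UNIV (shift T l)) < \<infinity>}"

definition iso :: "complex set \<Rightarrow> complex set" where
  "iso A = {l. l isolated_in A}"

definition pi_0 :: "('a :: complex_banach \<Rightarrow> 'a) \<Rightarrow> complex set" where
  "pi_0 T = iso (spectrum T) \<inter> eigenvalues T"

definition pi_00 :: "('a :: complex_banach \<Rightarrow> 'a) \<Rightarrow> complex set" where
  "pi_00 T = iso (spectrum T) \<inter> finite_mult_eigenvalues T"


section \<open>The four properties\<close>

definition property_w :: "('a :: complex_banach \<Rightarrow> 'a) \<Rightarrow> bool" where
  "property_w T \<longleftrightarrow> approx_point_spectrum T - sigma_uw T = pi_00 T"

definition property_gw :: "('a :: complex_banach \<Rightarrow> 'a) \<Rightarrow> bool" where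
  "property_gw T \<longleftrightarrow> approx_point_spectrum T - sigma_ubw T = pi_0 T"

definition property_w_pi00 :: "('a :: complex_banach \<Rightarrow> 'a) \<Rightarrow> bool" where
  "property_w_pi00 T \<longleftrightarrow> approx_point_spectrum T - sigma_uf T = pi_00 T"

definition property_gw_pi00 :: "('a :: complex_banach \<Rightarrow> 'a) \<Rightarrow> bool" where
  "property_gw_pi00 T \<longleftrightarrow> approx_point_spectrum T - sigma_ubf T = pi_0 T"

end

theory Submission
  imports Defs
begin

text \<open>
  In both parts the implication from right to left is a substitution of one spectrum for the
  other. For the converse, every (B-)Weyl operator is (B-)Fredholm by definition, so the issue is
  to show that a point \<open>l\<close> outside \<open>\<sigma>\<^sub>u\<^sub>f\<close> (or \<open>\<sigma>\<^sub>u\<^sub>b\<^sub>f\<close>) gives \<open>S = T - l I\<close> an index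
  at most 0. The assumed property leaves two possibilities: either \<open>l\<close> is not an
  approximate eigenvalue, and \<open>S\<close> is injective, or \<open>l\<close> is isolated in the spectrum, and
  \<open>S - \<mu> I\<close> is invertible for all small \<open>\<mu> \<noteq> 0\<close>. Either way \<open>S - \<mu> I\<close> is injective for arbitrarily
  small \<open>\<mu>\<close> (lemma \<open>injective_shifts_nearby\<close>), and this injectivity passes to every
  subspace, in particular to the range of \<open>S\<^sup>n\<close> on which the B-index is computed.

  The analytic core is therefore a one-sided form of the stability of the index, on
  a closed \<open>S\<close>-invariant subspace \<open>V\<close>: if \<open>S - \<mu> I\<close> is injective on \<open>V\<close> for
  arbitrarily small \<open>\<mu>\<close>, then the kernel \<open>N\<close> of \<open>S\<close> on \<open>V\<close> satisfies \<open>dim N \<le> codim S(V)\<close>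
  (lemma \<open>card_kernel_basis_le\<close>). Let \<open>F\<close> be the span of representatives of a finite basis of
  \<open>V / S(V)\<close>. Since \<open>V = S(V) + F\<close>, an open mapping argument solves \<open>y = S x + f\<close> with
  \<open>f \<in> F\<close> and control of the norms (lemma \<open>bounded_solutions\<close>). Iterating it from
  \<open>e \<in> N\<close> gives the coefficients of a power series \<open>x(\<mu>) = e + \<mu> x\<^sub>1 + \<mu>\<^sup>2 x\<^sub>2 + \<dots>\<close> with
  \<open>(S - \<mu> I) x(\<mu>) \<in> F\<close> (lemma \<open>kernel_vector_perturbation\<close>). Doing this for each vector of a basis of \<open>N\<close>
  yields, for small \<open>\<mu>\<close>, linearly independent vectors \<open>x(\<mu>)\<close>, whose images under the injective map
  \<open>S - \<mu> I\<close> are independent vectors of \<open>F\<close>; hence \<open>dim N \<le> dim F\<close>.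
\<close>

section \<open>Absorbing convex sets in Banach spaces\<close>

text \<open>
  By the Baire category theorem some multiple of the closure of \<open>A\<close>, hence that closure itself,
  has interior points relative to \<open>W\<close>; symmetry and convexity then move the interior to the origin.
\<close>

lemma absorbing_convex_closure_interior:
  fixes W A :: "'a::banach set"
  assumes W: "subspace W" "closed W" and AW: "A \<subseteq> W"
    and conv: "convex A" and sym: "\<And>a. a \<in> A \<Longrightarrow> - a \<in> A"
    and absorb: "\<And>w. w \<in> W \<Longrightarrow> \<exists>n. \<exists>a\<in>A. w = real (Suc n) *\<^sub>R a"
  obtains r where "r > 0" "\<And>y. y \<in> W \<Longrightarrow> norm y < r \<Longrightarrow> y \<in> closure A"
proof -
  define F where "F n = (*\<^sub>R) (real (Suc n)) ` closure A" for n
  have clAW: "closure A \<subseteq> W" using AW W(2) by (rule closure_minimal)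
  have F_closed: "closed (F n)" for n
    unfolding F_def by (rule closed_scaling) simp
  have F_W: "F n \<subseteq> W" for n
    using clAW W(1) by (auto simp: F_def subspace_def)
  have W_cover: "W = \<Union> (range F)"
    using F_W absorb closure_subset[of A] by (fastforce simp: F_def)
  have "\<exists>n. top_of_set W interior_of F n \<noteq> {}"
  proof (rule ccontr)
    assume "\<nexists>n. top_of_set W interior_of F n \<noteq> {}"
    then have "top_of_set W interior_of \<Union> (range F) = {}"
      using W(2) F_closed F_W
      by (intro Baire_category_alt)
        (auto simp: closed_subset intro!: disjI1 completely_metrizable_space_closedin
          completely_metrizable_space_euclidean)
    then have "W = {}"
      using W_cover interior_of_topspace[of "top_of_set W"] by simp
    then show False using subspace_0[OF W(1)] by simp
  qed
  then obtain n w0 where "w0 \<in> top_of_set W interior_of F n" by blast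
  then obtain U where U: "openin (top_of_set W) U" "U \<subseteq> F n" "w0 \<in> U"
    by (auto simp: interior_of_def)
  then obtain e where w0: "w0 \<in> W" "e > 0" "\<And>y. y \<in> W \<Longrightarrow> dist w0 y < e \<Longrightarrow> y \<in> F n"
    unfolding openin_euclidean_subtopology_iff by (metis dist_commute subsetD)
  have clsym: "- a \<in> closure A" if "a \<in> closure A" for a
  proof -
    have "(*\<^sub>R) (-1) ` A \<subseteq> A" using sym by auto
    then have "(*\<^sub>R) (-1) ` closure A \<subseteq> closure A"
      unfolding closure_scaleR by (rule closure_mono)
    then show ?thesis using that by force
  qed
  define r where "r = e / real (Suc n)"
  have "y \<in> closure A" if y: "y \<in> W" "norm y < r" for y
  proof -
    let ?k = "real (Suc n)"
    have "norm (?k *\<^sub>R y) < e"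
      using y by (simp add: r_def pos_less_divide_eq mult.commute del: of_nat_Suc)
    then have "w0 + ?k *\<^sub>R y \<in> F n" "w0 - ?k *\<^sub>R y \<in> F n"
      using y w0(1) W(1) by (auto intro!: w0(3) simp: subspace_add subspace_diff subspace_scale dist_norm)
    then obtain p q where pq: "p \<in> closure A" "q \<in> closure A"
      "w0 + ?k *\<^sub>R y = ?k *\<^sub>R p" "w0 - ?k *\<^sub>R y = ?k *\<^sub>R q"
      by (auto simp: F_def)
    have "?k *\<^sub>R (2 *\<^sub>R y) = (w0 + ?k *\<^sub>R y) - (w0 - ?k *\<^sub>R y)"
      by (simp add: scaleR_2 scaleR_add_right del: of_nat_Suc)
    also have "\<dots> = ?k *\<^sub>R (p - q)"
      unfolding pq(3,4) by (rule scaleR_diff_right[symmetric])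
    finally have "?k *\<^sub>R (2 *\<^sub>R y) = ?k *\<^sub>R (p - q)" .
    then have "2 *\<^sub>R y = p - q" by (rule real_vector.scale_left_imp_eq[rotated]) simp
    then have "(1/2) *\<^sub>R (2 *\<^sub>R y) = (1/2) *\<^sub>R (p - q)" by (rule arg_cong)
    then have "y = (1/2) *\<^sub>R p + (1/2) *\<^sub>R (- q)"
      by (simp add: scaleR_diff_right)
    then show ?thesis
      using convexD[OF convex_closure[OF conv] pq(1) clsym[OF pq(2)], of "1/2" "1/2"] by simp
  qed
  moreover have "r > 0" using w0(2) by (simp add: r_def)
  ultimately show ?thesis using that by blast
qed

text \<open>
  The successive approximation step of the open mapping theorem, isolated from any operator: a
  point near the origin is corrected by elements of \<open>A\<close> with weights halving each time, and
  closedness of \<open>A\<close> under such infinite convex combinations puts the limit back into \<open>A\<close>. This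
  removes the closure from the preceding lemma.
\<close>

lemma absorbing_cs_convex_contains_ball:
  fixes W A :: "'a::banach set"
  assumes W: "subspace W" "closed W" and AW: "A \<subseteq> W"
    and conv: "convex A" and sym: "\<And>a. a \<in> A \<Longrightarrow> - a \<in> A"
    and absorb: "\<And>w. w \<in> W \<Longrightarrow> \<exists>n. \<exists>a\<in>A. w = real (Suc n) *\<^sub>R a"
    and series: "\<And>a. (\<And>n. a n \<in> A) \<Longrightarrow> \<exists>s\<in>A. (\<lambda>n. (1/2) ^ Suc n *\<^sub>R a n) sums s"
  obtains r where "r > 0" "\<And>y. y \<in> W \<Longrightarrow> norm y < r \<Longrightarrow> y \<in> A"
proof -
  obtain r where r: "r > 0" "\<And>y. y \<in> W \<Longrightarrow> norm y < r \<Longrightarrow> y \<in> closure A"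
    using absorbing_convex_closure_interior[OF W AW conv sym absorb] by blast
  have "\<exists>a. a \<in> A \<and> norm (y - a) < r / 2" if "y \<in> W" "norm y < r" for y
    using closure_approachableD[OF r(2)[OF that], of "r/2"] r(1) by (auto simp: dist_norm)
  then obtain a where a: "\<And>y. y \<in> W \<Longrightarrow> norm y < r \<Longrightarrow> a y \<in> A"
    "\<And>y. y \<in> W \<Longrightarrow> norm y < r \<Longrightarrow> norm (y - a y) < r / 2"
    by metis
  have "y \<in> A" if y: "y \<in> W" "norm y < r / 2" for y
  proof -
    (* z n is the error left after n corrections, rescaled by 2^(n+1) to stay in the ball of
       radius r; the initial factor 2 makes the weights 1/2, 1/4, ... add up to 1. *)
    define z where "z n = ((\<lambda>v. 2 *\<^sub>R (v - a v)) ^^ n) (2 *\<^sub>R y)" for n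
    have z_Suc: "z (Suc n) = 2 *\<^sub>R (z n - a (z n))" for n by (simp add: z_def)
    have z: "z n \<in> W \<and> norm (z n) < r" for n
    proof (induction n)
      case 0
      then show ?case using y W(1) by (simp add: z_def subspace_scale)
    next
      case (Suc n)
      then show ?case
        using a[of "z n"] AW W(1) unfolding z_Suc by (auto intro!: subspace_scale subspace_diff)
    qed
    have partial: "(\<Sum>i<n. (1/2) ^ Suc i *\<^sub>R a (z i)) = y - (1/2) ^ Suc n *\<^sub>R z n" for n
    proof (induction n)
      case 0
      then show ?case by (simp add: z_def)
    next
      case (Suc n)
      then show ?case by (simp add: z_Suc algebra_simps)
    qed
    have "(\<lambda>n. (1/2) ^ Suc n *\<^sub>R z n) \<longlonglongrightarrow> 0"
    proof (rule Lim_null_comparison)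
      show "\<forall>\<^sub>F n in sequentially. norm ((1/2) ^ Suc n *\<^sub>R z n) \<le> (1/2) ^ Suc n * r"
        using z by (intro always_eventually allI) (simp add: less_imp_le)
      show "(\<lambda>n. (1/2) ^ Suc n * r) \<longlonglongrightarrow> 0"
        by (intro tendsto_mult_left_zero LIMSEQ_Suc LIMSEQ_power_zero) simp
    qed
    from tendsto_diff[OF tendsto_const[of y] this]
    have "(\<lambda>n. (1/2) ^ Suc n *\<^sub>R a (z n)) sums y"
      unfolding sums_def partial by simp
    moreover obtain s where "s \<in> A" "(\<lambda>n. (1/2) ^ Suc n *\<^sub>R a (z n)) sums s"
      using series[of "\<lambda>n. a (z n)"] a(1) z by blast
    ultimately show ?thesis using sums_unique2 by metis
  qed
  then show ?thesis using that[of "r/2"] r(1) by simp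
qed

section \<open>Operator equations with a finite-dimensional correction\<close>

lemma closed_subspace_sums:
  fixes V :: "'a::real_normed_vector set"
  assumes V: "subspace V" "closed V" and f: "\<And>n. f n \<in> V" and s: "f sums s"
  shows "s \<in> V"
  using s unfolding sums_def
  by (rule closed_sequentially[OF V(2), rotated]) (intro subspace_sum V(1) f)

interpretation cvs: vector_space "scaleC :: complex \<Rightarrow> 'a::complex_banach \<Rightarrow> 'a"
  by (rule vector_space_scaleC)

lemma cvs_subspace_imp_subspace: "cvs.subspace V \<Longrightarrow> subspace V"
  unfolding subspace_def cvs.subspace_def by (metis scaleC_of_real)

lemma scaleC_scaleR: "c *\<^sub>C (r *\<^sub>R x) = (complex_of_real r * c) *\<^sub>C (x::'a::complex_banach)"
  by (metis mult.commute scaleC_of_real scaleC_scaleC)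

lemma scaleR_scaleC: "r *\<^sub>R (c *\<^sub>C x) = (complex_of_real r * c) *\<^sub>C (x::'a::complex_banach)"
  by (metis scaleC_of_real scaleC_scaleC)

lemma bounded_linear_scaleC_left: "bounded_linear (\<lambda>c. c *\<^sub>C (x::'a::complex_banach))"
  by (rule bounded_linear_intro[of _ "norm x"])
    (simp_all add: scaleC_add_left norm_scaleC scaleR_scaleC scaleR_conv_of_real)

lemma bounded_linear_scaleC_right: "bounded_linear (\<lambda>x. c *\<^sub>C (x::'a::complex_banach))"
  by (rule bounded_linear_intro[of _ "cmod c"])
    (simp_all add: scaleC_add_right norm_scaleC scaleC_scaleR scaleR_scaleC)

lemma bounded_clinearD:
  assumes "bounded_clinear S"
  shows "bounded_linear S" "S (c *\<^sub>C x) = c *\<^sub>C S x"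
  using assms by (auto simp: bounded_clinear_def)

text \<open>
  The open mapping theorem for the surjection \<open>(x, c) \<mapsto> S x + \<Sum> c\<^sub>b b\<close> from \<open>V \<times> \<complex>\<^sup>B\<close> onto \<open>W\<close>: the
  image \<open>A\<close> of the unit ball is absorbing and closed under infinite convex combinations, so it
  contains a ball of \<open>W\<close>. When \<open>S\<close> vanishes on \<open>V\<close>, it bounds
  the coefficients of a vector in a finite basis of \<open>W\<close>; both uses occur below.
\<close>

lemma bounded_solutions:
  fixes S :: "'a::complex_banach \<Rightarrow> 'a"
  assumes S: "bounded_clinear S"
    and V: "cvs.subspace V" "closed V" and W: "cvs.subspace W" "closed W"
    and SV: "S ` V \<subseteq> W" and B: "finite B" "B \<subseteq> W"
    and onto: "\<And>y. y \<in> W \<Longrightarrow> \<exists>x\<in>V. \<exists>c. y = S x + (\<Sum>b\<in>B. c b *\<^sub>C b)"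
  obtains C where "C > 0"
    "\<And>y. y \<in> W \<Longrightarrow> \<exists>x\<in>V. \<exists>c. y = S x + (\<Sum>b\<in>B. c b *\<^sub>C b) \<and>
        norm x \<le> C * norm y \<and> (\<forall>b\<in>B. cmod (c b) \<le> C * norm y)"
proof -
  interpret S: bounded_linear S by (rule bounded_clinearD[OF S])
  define P where "P x c = S x + (\<Sum>b\<in>B. c b *\<^sub>C b)" for x and c :: "'a \<Rightarrow> complex"
  have P_add: "P (x + x') (\<lambda>b. c b + c' b) = P x c + P x' c'" for x x' c c'
    by (simp add: P_def S.add scaleC_add_left sum.distrib)
  have P_scale: "P (r *\<^sub>R x) (\<lambda>b. of_real r * c b) = r *\<^sub>R P x c" for r x c
    by (simp add: P_def S.scaleR scaleR_add_right scaleR_sum_right scaleR_scaleC)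
  define U where "U = {(x, c). x \<in> V \<and> norm x \<le> 1 \<and> (\<forall>b\<in>B. cmod (c b) \<le> 1)}"
  define A where "A = {P x c |x c. (x, c) \<in> U}"
  have rV: "subspace V" and rW: "subspace W"
    using V(1) W(1) by (auto intro: cvs_subspace_imp_subspace)
  have PW: "P x c \<in> W" if "x \<in> V" for x c
    unfolding P_def using SV B that
    by (intro cvs.subspace_add W cvs.subspace_sum cvs.subspace_scale) auto
  have "\<exists>r>0. \<forall>y\<in>W. norm y < r \<longrightarrow> y \<in> A"
  proof (rule absorbing_cs_convex_contains_ball[OF rW W(2), of A])
    show "A \<subseteq> W" using PW by (auto simp: A_def U_def)
    show "convex A"
    proof (rule convexI)
      fix p q and u v :: real
      assume "p \<in> A" "q \<in> A" and uv: "0 \<le> u" "0 \<le> v" "u + v = 1"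
      then obtain x c x' c' where xc: "(x, c) \<in> U" "(x', c') \<in> U" "p = P x c" "q = P x' c'"
        by (auto simp: A_def)
      have *: "norm (u *\<^sub>R a + v *\<^sub>R b) \<le> 1" if "norm a \<le> 1" "norm b \<le> 1"
        for a b :: "'b::real_normed_vector"
        using convexD[OF convex_cball[of "0::'b" 1], of a b u v] that uv by simp
      have "(u *\<^sub>R x + v *\<^sub>R x', \<lambda>b. of_real u * c b + of_real v * c' b) \<in> U"
        using xc(1,2) rV *[of x x'] *[of "c _" "c' _"]
        by (auto simp: U_def subspace_add subspace_scale scaleR_conv_of_real)
      then show "u *\<^sub>R p + v *\<^sub>R q \<in> A"
        unfolding xc(3,4) A_def P_scale[symmetric] P_add[symmetric] by blast
    qed
    show "- p \<in> A" if p: "p \<in> A" for p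
    proof -
      obtain x c where xc: "(x, c) \<in> U" "p = P x c" using p by (auto simp: A_def)
      then have "((-1) *\<^sub>R x, \<lambda>b. of_real (-1) * c b) \<in> U"
        using rV by (auto simp: U_def subspace_neg)
      moreover have "- p = P ((-1) *\<^sub>R x) (\<lambda>b. of_real (-1) * c b)"
        unfolding P_scale xc(2) by simp
      ultimately show ?thesis unfolding A_def by blast
    qed
    show "\<exists>n. \<exists>a\<in>A. w = real (Suc n) *\<^sub>R a" if w: "w \<in> W" for w
    proof -
      obtain x c where xc: "x \<in> V" "w = P x c" using onto[OF w] by (auto simp: P_def)
      obtain n :: nat where n: "norm x + (\<Sum>b\<in>B. cmod (c b)) \<le> real n"
        using real_arch_simple by blast
      let ?r = "inverse (real (Suc n))"
      have "cmod (c b) \<le> (\<Sum>b\<in>B. cmod (c b))" if "b \<in> B" for b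
        using that B(1) by (intro member_le_sum) auto
      moreover have "0 \<le> norm x" "0 \<le> (\<Sum>b\<in>B. cmod (c b))" by (simp_all add: sum_nonneg)
      ultimately have "norm x \<le> real (Suc n)" "\<And>b. b \<in> B \<Longrightarrow> cmod (c b) \<le> real (Suc n)"
        using n by (force, smt (verit) of_nat_Suc)
      then have "(?r *\<^sub>R x, \<lambda>b. of_real ?r * c b) \<in> U"
        using xc(1) rV
        by (auto simp: U_def subspace_scale norm_mult norm_divide field_simps simp del: of_nat_Suc)
      then have "?r *\<^sub>R w \<in> A" unfolding xc(2) A_def P_scale[symmetric] by blast
      moreover have "w = real (Suc n) *\<^sub>R (?r *\<^sub>R w)" by simp
      ultimately show ?thesis by blast
    qed
    show "\<exists>s\<in>A. (\<lambda>n. (1/2) ^ Suc n *\<^sub>R a n) sums s" if a: "\<And>n. a n \<in> A" for a :: "nat \<Rightarrow> 'a"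
    proof -
      have "\<forall>n. \<exists>x c. (x, c) \<in> U \<and> a n = P x c" using a unfolding A_def by blast
      then obtain x c where xc: "\<And>n. (x n, c n) \<in> U" "\<And>n. a n = P (x n) (c n)" by metis
      have halves: "(\<lambda>n. (1/2::real) ^ Suc n) sums 1"
        using power_half_series by simp
      have conv: "summable (\<lambda>n. (1/2) ^ Suc n *\<^sub>R u n) \<and> norm (\<Sum>n. (1/2) ^ Suc n *\<^sub>R u n) \<le> 1"
        if u: "\<And>n. norm (u n) \<le> 1" for u :: "nat \<Rightarrow> 'b::banach"
      proof -
        have le: "norm ((1/2) ^ Suc n *\<^sub>R u n) \<le> (1/2) ^ Suc n" for n
          using mult_left_le[OF u[of n], of "(1/2) ^ Suc n"] by simp
        have "norm (\<Sum>n. (1/2) ^ Suc n *\<^sub>R u n) \<le> (\<Sum>n. (1/2) ^ Suc n)"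
          by (rule norm_suminf_le[OF le sums_summable[OF halves]])
        then show ?thesis
          using summable_comparison_test'[OF sums_summable[OF halves] le] sums_unique[OF halves]
          by auto
      qed
      define X where "X = (\<Sum>n. (1/2) ^ Suc n *\<^sub>R x n)"
      define K where "K b = (\<Sum>n. (1/2) ^ Suc n *\<^sub>R c n b)" for b
      have X: "(\<lambda>n. (1/2) ^ Suc n *\<^sub>R x n) sums X" "norm X \<le> 1"
        using conv[of x] xc(1) unfolding X_def by (auto simp: U_def summable_sums)
      have K: "(\<lambda>n. (1/2) ^ Suc n *\<^sub>R c n b) sums K b" "cmod (K b) \<le> 1" if "b \<in> B" for b
        using conv[of "\<lambda>n. c n b"] xc(1) that unfolding K_def by (auto simp: U_def summable_sums)
      have "X \<in> V"
        using xc(1) rV by (intro closed_subspace_sums[OF rV V(2) _ X(1)])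
          (auto simp: U_def intro!: subspace_scale)
      then have "(X, K) \<in> U" using X(2) K(2) by (auto simp: U_def)
      moreover have "(\<lambda>n. S ((1/2) ^ Suc n *\<^sub>R x n) +
          (\<Sum>b\<in>B. ((1/2) ^ Suc n *\<^sub>R c n b) *\<^sub>C b)) sums P X K"
        unfolding P_def using K(1)
        by (intro sums_add S.sums X(1) sums_sum
            bounded_linear.sums[OF bounded_linear_scaleC_left])
      then have "(\<lambda>n. (1/2) ^ Suc n *\<^sub>R a n) sums P X K"
        unfolding xc(2) P_scale[symmetric] by (simp add: P_def scaleR_conv_of_real)
      ultimately show ?thesis unfolding A_def by blast
    qed
  qed blast
  then obtain r where r: "r > 0" "\<And>y. y \<in> W \<Longrightarrow> norm y < r \<Longrightarrow> y \<in> A" by blast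
  have "\<exists>x\<in>V. \<exists>c. y = S x + (\<Sum>b\<in>B. c b *\<^sub>C b) \<and>
        norm x \<le> 2 / r * norm y \<and> (\<forall>b\<in>B. cmod (c b) \<le> 2 / r * norm y)" if y: "y \<in> W" for y
  proof (cases "y = 0")
    case True
    then show ?thesis
      using cvs.subspace_0[OF V(1)] by (intro bexI[of _ 0] exI[of _ "\<lambda>_. 0"]) (simp_all add: S.zero)
  next
    case False
    define t where "t = 2 / r * norm y"
    have t: "t > 0" using False r(1) by (simp add: t_def)
    have "norm (inverse t *\<^sub>R y) = r / 2" using False r(1) by (simp add: t_def field_simps)
    then have "inverse t *\<^sub>R y \<in> A"
      using r y rW by (intro r(2)) (auto simp: subspace_scale)
    then obtain x c where xc: "(x, c) \<in> U" "inverse t *\<^sub>R y = P x c" by (auto simp: A_def)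
    have "t *\<^sub>R (inverse t *\<^sub>R y) = y" using t by simp
    then have "y = P (t *\<^sub>R x) (\<lambda>b. of_real t * c b)" unfolding xc(2) P_scale by simp
    moreover have "t *\<^sub>R x \<in> V" "norm (t *\<^sub>R x) \<le> t" "\<forall>b\<in>B. cmod (of_real t * c b) \<le> t"
      using xc(1) t rV by (auto simp: U_def subspace_scale norm_mult)
    ultimately show ?thesis
      unfolding P_def t_def
      by (intro bexI[of _ "(2 / r * norm y) *\<^sub>R x"]
          exI[of _ "\<lambda>b. of_real (2 / r * norm y) * c b"] conjI)
  qed
  then show ?thesis using that[of "2 / r"] r(1) by simp
qed

section \<open>Kernels under small perturbations\<close>

lemma bchoice_pair: "\<forall>x\<in>A. \<exists>y z. P x y z \<Longrightarrow> \<exists>f g. \<forall>x\<in>A. P x (f x) (g x)"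
  by metis

text \<open>
  Put \<open>x\<^sub>0 = e\<close> and solve \<open>x\<^sub>n = S x\<^sub>n\<^sub>+\<^sub>1 + f\<^sub>n\<close> with \<open>f\<^sub>n\<close> in the span of \<open>B\<close>. For \<open>x = \<Sum> \<mu>\<^sup>n x\<^sub>n\<close> the
  contributions of the \<open>x\<^sub>n\<close> to \<open>S x - \<mu> x\<close> telescope, leaving \<open>S e = 0\<close> and \<open>- \<Sum> \<mu>\<^sup>n\<^sup>+\<^sup>1 f\<^sub>n\<close>.
  As \<open>x\<^sub>n\<close> and the coefficients of \<open>f\<^sub>n\<close> grow at most like powers of \<open>C\<close>, everything converges
  geometrically once \<open>\<bar>\<mu>\<bar> C \<le> 1/2\<close>, and \<open>x\<close> differs from \<open>e\<close> by \<open>O(\<mu>)\<close>.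
\<close>

lemma kernel_vector_perturbation:
  fixes S :: "'a::complex_banach \<Rightarrow> 'a"
  assumes S: "bounded_clinear S" and V: "cvs.subspace V" "closed V"
    and C: "C > 0"
    and sol: "\<And>y. y \<in> V \<Longrightarrow> \<exists>x\<in>V. \<exists>c. y = S x + (\<Sum>b\<in>B. c b *\<^sub>C b) \<and>
        norm x \<le> C * norm y \<and> (\<forall>b\<in>B. cmod (c b) \<le> C * norm y)"
    and e: "e \<in> V" "S e = 0" and \<mu>: "cmod \<mu> * C \<le> 1 / 2"
  obtains x c where "x \<in> V" "norm (x - e) \<le> 2 * (cmod \<mu> * C * norm e)"
    "S x - \<mu> *\<^sub>C x = (\<Sum>b\<in>B. c b *\<^sub>C b)"
proof -
  interpret S: bounded_linear S by (rule bounded_clinearD[OF S])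
  have "\<forall>y\<in>V. \<exists>x c. x \<in> V \<and> y = S x + (\<Sum>b\<in>B. c b *\<^sub>C b) \<and>
      norm x \<le> C * norm y \<and> (\<forall>b\<in>B. cmod (c b) \<le> C * norm y)"
    using sol by blast
  from bchoice_pair[OF this] obtain g k where g: "\<And>y. y \<in> V \<Longrightarrow> g y \<in> V"
      "\<And>y. y \<in> V \<Longrightarrow> y = S (g y) + (\<Sum>b\<in>B. k y b *\<^sub>C b)"
      "\<And>y. y \<in> V \<Longrightarrow> norm (g y) \<le> C * norm y"
      "\<And>y b. y \<in> V \<Longrightarrow> b \<in> B \<Longrightarrow> cmod (k y b) \<le> C * norm y"
    by blast
  define X where "X n = (g ^^ n) e" for n
  have X_Suc: "X (Suc n) = g (X n)" for n by (simp add: X_def)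
  have X_V: "X n \<in> V" for n
    by (induction n) (use e g in \<open>auto simp: X_def\<close>)
  have X_norm: "norm (X n) \<le> C ^ n * norm e" for n
  proof (induction n)
    case 0
    then show ?case by (simp add: X_def)
  next
    case (Suc n)
    have "norm (X (Suc n)) \<le> C * norm (X n)" unfolding X_Suc by (rule g(3)[OF X_V])
    also have "\<dots> \<le> C * (C ^ n * norm e)" using Suc C by (intro mult_left_mono) auto
    finally show ?case by (simp add: mult.assoc)
  qed
  define \<theta> where "\<theta> = cmod \<mu> * C"
  have \<theta>: "0 \<le> \<theta>" "\<theta> \<le> 1/2" using \<mu> C by (auto simp: \<theta>_def)
  have \<theta>_pow: "\<theta> ^ Suc n * norm e \<le> (\<theta> * norm e) * (1/2) ^ n" for n
    using mult_left_mono[OF power_mono[OF \<theta>(2) \<theta>(1), of n], of "\<theta> * norm e"] \<theta>(1)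
    by (simp add: mult_ac)
  (* t n are the terms of the power series; q b n is the coefficient at b of the remainder that
     the n-th equation contributes. *)
  define t where "t n = \<mu> ^ n *\<^sub>C X n" for n
  define q where "q b n = \<mu> ^ Suc n * k (X n) b" for b n
  have t_norm: "norm (t (Suc n)) \<le> (\<theta> * norm e) * (1/2) ^ n" for n
  proof -
    have "norm (t (Suc n)) \<le> cmod \<mu> ^ Suc n * (C ^ Suc n * norm e)"
      unfolding t_def norm_scaleC norm_power by (intro mult_left_mono X_norm) simp
    also have "\<dots> = \<theta> ^ Suc n * norm e" by (simp add: \<theta>_def power_mult_distrib mult_ac)
    finally show ?thesis using \<theta>_pow[of n] by linarith
  qed
  have q_norm: "cmod (q b n) \<le> (\<theta> * norm e) * (1/2) ^ n" if "b \<in> B" for b n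
  proof -
    have "cmod (k (X n) b) \<le> C * (C ^ n * norm e)"
      using g(4)[OF X_V that] mult_left_mono[OF X_norm[of n], of C] C by (meson order_trans less_imp_le)
    then have "cmod (q b n) \<le> cmod \<mu> ^ Suc n * (C * (C ^ n * norm e))"
      unfolding q_def norm_mult norm_power by (intro mult_left_mono) simp_all
    also have "\<dots> = \<theta> ^ Suc n * norm e" by (simp add: \<theta>_def power_mult_distrib mult_ac)
    finally show ?thesis using \<theta>_pow[of n] by linarith
  qed
  have geometric: "(\<lambda>n. (\<theta> * norm e) * (1/2) ^ n) sums (2 * (\<theta> * norm e))"
    using sums_mult[OF geometric_sums[of "1/2::real"], of "\<theta> * norm e"] by (simp add: mult_ac)
  have sum_tail: "summable (\<lambda>n. t (Suc n))"
    using summable_comparison_test'[OF sums_summable[OF geometric] t_norm] .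
  define x where "x = suminf t"
  have x_sums: "t sums x"
    unfolding x_def using sum_tail by (simp add: summable_Suc_iff summable_sums)
  then have tail_sums: "(\<lambda>n. t (Suc n)) sums (x - e)"
    using sums_Suc_iff[of t "x - e"] by (simp add: t_def X_def scaleC_one)
  have "norm (x - e) \<le> 2 * (\<theta> * norm e)"
    using norm_suminf_le[OF t_norm sums_summable[OF geometric]] tail_sums geometric
    by (simp add: sums_iff)
  moreover have "x \<in> V"
    using X_V V(1)
    by (intro closed_subspace_sums[OF cvs_subspace_imp_subspace V(2) _ x_sums])
      (auto simp: t_def intro: cvs.subspace_scale)
  moreover have "S x - \<mu> *\<^sub>C x = (\<Sum>b\<in>B. (- suminf (q b)) *\<^sub>C b)"
  proof -
    have "S (t (Suc n)) = \<mu> *\<^sub>C t n - (\<Sum>b\<in>B. q b n *\<^sub>C b)" for n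
    proof -
      have "S (X (Suc n)) = X n - (\<Sum>b\<in>B. k (X n) b *\<^sub>C b)"
        using g(2)[OF X_V[of n]] by (simp add: X_Suc algebra_simps)
      then show ?thesis
        by (simp add: t_def q_def bounded_clinearD(2)[OF S] cvs.scale_right_diff_distrib
            cvs.scale_sum_right mult_ac scaleC_scaleC)
    qed
    moreover have "(\<lambda>n. \<mu> *\<^sub>C t n - (\<Sum>b\<in>B. q b n *\<^sub>C b)) sums
        (\<mu> *\<^sub>C x - (\<Sum>b\<in>B. suminf (q b) *\<^sub>C b))"
    proof (intro sums_diff sums_sum)
      show "(\<lambda>n. \<mu> *\<^sub>C t n) sums (\<mu> *\<^sub>C x)"
        by (rule bounded_linear.sums[OF bounded_linear_scaleC_right x_sums])
      fix b assume "b \<in> B"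
      from summable_comparison_test'[OF sums_summable[OF geometric] q_norm[OF this]]
      show "(\<lambda>n. q b n *\<^sub>C b) sums (suminf (q b) *\<^sub>C b)"
        by (intro bounded_linear.sums[OF bounded_linear_scaleC_left]) (rule summable_sums)
    qed
    ultimately have "(\<lambda>n. S (t (Suc n))) sums (\<mu> *\<^sub>C x - (\<Sum>b\<in>B. suminf (q b) *\<^sub>C b))"
      by simp
    moreover have "(\<lambda>n. S (t (Suc n))) sums S (x - e)" by (rule S.sums[OF tail_sums])
    ultimately have "S (x - e) = \<mu> *\<^sub>C x - (\<Sum>b\<in>B. suminf (q b) *\<^sub>C b)"
      by (rule sums_unique2[rotated])
    then show ?thesis
      by (simp add: S.diff e(2) cvs.scale_minus_left sum_negf)
  qed
  ultimately show ?thesis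
    unfolding \<theta>_def by (intro that[of x "\<lambda>b. - suminf (q b)"])
qed

text \<open>
  Each basis vector \<open>e\<close> of the kernel is moved slightly to some \<open>x\<^sub>e\<close> with \<open>(S - \<mu> I) x\<^sub>e\<close> in the span of
  \<open>B\<close>. A relation between these images pulls back, by injectivity of \<open>S - \<mu> I\<close>, to a relation
  \<open>\<Sum> d\<^sub>e x\<^sub>e = 0\<close>. Then \<open>v = \<Sum> d\<^sub>e e\<close> equals \<open>\<Sum> d\<^sub>e (e - x\<^sub>e)\<close>, where every \<open>\<bar>d\<^sub>e\<bar>\<close> is at most a
  constant times the norm of \<open>v\<close> and every \<open>e - x\<^sub>e\<close> is small; so \<open>v = 0\<close> and all \<open>d\<^sub>e\<close> vanish. The images
  are thus independent, and they are as many as the elements of \<open>E\<close>.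
\<close>

lemma card_kernel_basis_le:
  fixes S :: "'a::complex_banach \<Rightarrow> 'a"
  assumes S: "bounded_clinear S" and V: "cvs.subspace V" "closed V" and SV: "S ` V \<subseteq> V"
    and B: "finite B" "B \<subseteq> V" and quot: "\<And>v. v \<in> V \<Longrightarrow> \<exists>c. v - (\<Sum>b\<in>B. c b *\<^sub>C b) \<in> S ` V"
    and E: "finite E" "cvs.independent E" "cvs.span E = kernel_on V S"
    and inj: "\<And>\<epsilon>. \<epsilon> > 0 \<Longrightarrow> \<exists>\<mu>. cmod \<mu> < \<epsilon> \<and> (\<forall>x\<in>V. S x = \<mu> *\<^sub>C x \<longrightarrow> x = 0)"
  shows "card E \<le> card B"
proof -
  interpret S: bounded_linear S by (rule bounded_clinearD[OF S])
  note S_scale = bounded_clinearD(2)[OF S]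
  let ?N = "kernel_on V S"
  have N_sub: "cvs.subspace ?N" using E(3) cvs.subspace_span[of E] by simp
  have "?N = V \<inter> S -` {0}" by (auto simp: kernel_on_def)
  then have N_closed: "closed ?N"
    using V(2) by (simp add: closed_Int closed_vimage S.continuous_on continuous_on_id)
  have EN: "E \<subseteq> ?N" using cvs.span_superset[of E] E(3) by simp
  have EV: "e \<in> V" "S e = 0" if "e \<in> E" for e using EN that by (auto simp: kernel_on_def)
  obtain C where C: "C > 0"
    "\<And>y. y \<in> V \<Longrightarrow> \<exists>x\<in>V. \<exists>c. y = S x + (\<Sum>b\<in>B. c b *\<^sub>C b) \<and>
        norm x \<le> C * norm y \<and> (\<forall>b\<in>B. cmod (c b) \<le> C * norm y)"
  proof (rule bounded_solutions[OF S V V SV B])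
    fix y assume "y \<in> V"
    then obtain c x where "x \<in> V" "y - (\<Sum>b\<in>B. c b *\<^sub>C b) = S x" using quot by blast
    then show "\<exists>x\<in>V. \<exists>c. y = S x + (\<Sum>b\<in>B. c b *\<^sub>C b)"
      by (metis diff_add_cancel)
  qed blast
  (* On the kernel S vanishes, so that the same estimate bounds the coefficients in the basis E. *)
  obtain D where D: "D > 0"
    "\<And>y. y \<in> ?N \<Longrightarrow> \<exists>x\<in>?N. \<exists>c. y = S x + (\<Sum>e\<in>E. c e *\<^sub>C e) \<and>
        norm x \<le> D * norm y \<and> (\<forall>e\<in>E. cmod (c e) \<le> D * norm y)"
  proof (rule bounded_solutions[OF S N_sub N_closed N_sub N_closed _ E(1) EN])
    show "S ` ?N \<subseteq> ?N"
      using cvs.subspace_0[OF N_sub] by (auto simp: kernel_on_def)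
    fix y assume "y \<in> ?N"
    then have "y \<in> cvs.span E" using E(3) by simp
    then obtain c where "y = (\<Sum>e\<in>E. c e *\<^sub>C e)" using cvs.span_finite[OF E(1)] by auto
    then show "\<exists>x\<in>?N. \<exists>c. y = S x + (\<Sum>e\<in>E. c e *\<^sub>C e)"
      using cvs.subspace_0[OF N_sub] S.zero by (metis add_0)
  qed blast
  have coeff: "cmod (d e) \<le> D * norm (\<Sum>e\<in>E. d e *\<^sub>C e)" if "e \<in> E" for d e
  proof -
    let ?v = "\<Sum>e\<in>E. d e *\<^sub>C e"
    have "?v \<in> ?N" using EN by (intro cvs.subspace_sum cvs.subspace_scale N_sub) auto
    then obtain x c where c: "x \<in> ?N" "?v = S x + (\<Sum>e\<in>E. c e *\<^sub>C e)"
      "\<forall>e\<in>E. cmod (c e) \<le> D * norm ?v"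
      using D(2) by blast
    have "(\<Sum>e\<in>E. (d e - c e) *\<^sub>C e) = 0"
      using c(1,2) by (simp add: kernel_on_def cvs.scale_left_diff_distrib sum_subtractf)
    then have "d e - c e = 0"
      using cvs.independentD[OF E(2) E(1) subset_refl, of "\<lambda>e. d e - c e" e] that by simp
    then show ?thesis using c(3) that by simp
  qed
  define M where "M = (\<Sum>e\<in>E. norm e)"
  have M: "M \<ge> 0" by (simp add: M_def sum_nonneg)
  (* The first bound makes the power series converge; the second makes the total displacement of
     a combination of the basis vectors smaller than the combination itself. *)
  define \<epsilon> where "\<epsilon> = min (1 / (2 * C)) (1 / (2 * C * D * M + 1))"
  have CDM: "2 * C * D * M + 1 > 0" using C(1) D(1) M by (simp add: add_nonneg_pos)
  have "\<epsilon> > 0" using C(1) CDM by (simp add: \<epsilon>_def)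
  then obtain \<mu> where \<mu>: "cmod \<mu> < \<epsilon>" "\<And>x. x \<in> V \<Longrightarrow> S x = \<mu> *\<^sub>C x \<Longrightarrow> x = 0"
    using inj by blast
  have \<mu>C: "cmod \<mu> * C \<le> 1 / 2"
    using \<mu>(1) C(1) by (simp add: \<epsilon>_def field_simps)
  have "2 * cmod \<mu> * C * D * M + cmod \<mu> < 1"
    using \<mu>(1) CDM by (simp add: \<epsilon>_def pos_less_divide_eq algebra_simps)
  then have small: "2 * cmod \<mu> * C * D * M < 1"
    using norm_ge_zero[of \<mu>] by linarith
  have "\<forall>e\<in>E. \<exists>x c. x \<in> V \<and> norm (x - e) \<le> 2 * (cmod \<mu> * C * norm e) \<and>
      S x - \<mu> *\<^sub>C x = (\<Sum>b\<in>B. c b *\<^sub>C b)"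
    using kernel_vector_perturbation[OF S V C EV \<mu>C] by blast
  from bchoice_pair[OF this] obtain x c where x: "\<And>e. e \<in> E \<Longrightarrow> x e \<in> V"
      "\<And>e. e \<in> E \<Longrightarrow> norm (x e - e) \<le> 2 * (cmod \<mu> * C * norm e)"
      "\<And>e. e \<in> E \<Longrightarrow> S (x e) - \<mu> *\<^sub>C x e = (\<Sum>b\<in>B. c e b *\<^sub>C b)"
    by blast
  define y where "y e = S (x e) - \<mu> *\<^sub>C x e" for e
  have y_span: "y ` E \<subseteq> cvs.span B"
    using x(3) by (auto simp: y_def intro!: cvs.span_sum cvs.span_scale intro: cvs.span_base)
  have no_relation: "d e = 0" if rel: "(\<Sum>e\<in>E. d e *\<^sub>C y e) = 0" and e: "e \<in> E" for d e
  proof -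
    let ?v = "\<Sum>e\<in>E. d e *\<^sub>C e" and ?u = "\<Sum>e\<in>E. d e *\<^sub>C x e"
    have "?u \<in> V" using x(1) by (intro cvs.subspace_sum cvs.subspace_scale V(1))
    moreover have "S ?u - \<mu> *\<^sub>C ?u = (\<Sum>e\<in>E. d e *\<^sub>C y e)"
      by (simp add: y_def S.sum S_scale cvs.scale_sum_right cvs.scale_right_diff_distrib
          sum_subtractf mult.commute)
    ultimately have "?u = 0" using \<mu>(2) rel by simp
    then have "?v = (\<Sum>e\<in>E. d e *\<^sub>C (e - x e))"
      by (simp add: cvs.scale_right_diff_distrib sum_subtractf)
    also have "norm \<dots> \<le> (\<Sum>e\<in>E. (D * norm ?v) * (2 * (cmod \<mu> * C * norm e)))"
      using coeff x(2) D(1)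
      by (intro order_trans[OF norm_sum] sum_mono)
        (auto simp: norm_scaleC norm_minus_commute intro!: mult_mono)
    also have "\<dots> = (2 * cmod \<mu> * C * D * M) * norm ?v"
      by (simp add: M_def sum_distrib_left sum_distrib_right mult_ac)
    finally have "norm ?v \<le> (2 * cmod \<mu> * C * D * M) * norm ?v" .
    then have "norm ?v = 0"
      using mult_strict_right_mono[OF small, of "norm ?v"] by (cases "?v = 0") auto
    then show ?thesis using coeff[OF e, of d] by simp
  qed
  have y_inj: "inj_on y E"
  proof (rule inj_onI, rule ccontr)
    fix p q assume pq: "p \<in> E" "q \<in> E" "y p = y q" "p \<noteq> q"
    let ?d = "\<lambda>e. if e = p then 1 else if e = q then - 1 else 0 :: complex"
    have "(\<Sum>e\<in>E. ?d e *\<^sub>C y e) = (\<Sum>e\<in>{p, q}. ?d e *\<^sub>C y e)"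
      using pq E(1) by (intro sum.mono_neutral_right) auto
    also have "\<dots> = 0" using pq by (simp add: scaleC_one cvs.scale_minus_left)
    finally show False using no_relation[of ?d p] pq by simp
  qed
  have "cvs.independent (y ` E)"
  proof (rule cvs.independent_if_scalars_zero)
    fix f v assume "(\<Sum>w\<in>y ` E. f w *\<^sub>C w) = 0" "v \<in> y ` E"
    then show "f v = 0"
      using no_relation[of "f \<circ> y"] by (auto simp: sum.reindex[OF y_inj])
  qed (use E(1) in simp)
  then have "card (y ` E) \<le> card B"
    using cvs.independent_span_bound[OF B(1) _ y_span] by blast
  then show ?thesis by (simp add: card_image[OF y_inj])
qed

section \<open>The index at the points in question\<close>

lemma index_on_nonpos:
  fixes S :: "'a::complex_banach \<Rightarrow> 'a"
  assumes S: "bounded_clinear S" and V: "cvs.subspace V" "closed V" and SV: "S ` V \<subseteq> V"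
    and fin: "cdim (kernel_on V S) < \<infinity>"
    and inj: "\<And>\<epsilon>. \<epsilon> > 0 \<Longrightarrow> \<exists>\<mu>. cmod \<mu> < \<epsilon> \<and> (\<forall>x\<in>V. S x = \<mu> *\<^sub>C x \<longrightarrow> x = 0)"
  shows "index_on V S \<le> 0"
proof -
  interpret S: bounded_linear S by (rule bounded_clinearD[OF S])
  let ?N = "kernel_on V S"
  have "\<exists>G. finite G \<and> ?N \<subseteq> cvs.span G"
    using fin unfolding cdim_def by (rule contrapos_pp) simp
  then obtain G where G: "finite G" "?N \<subseteq> cvs.span G" by blast
  then have dimN: "cdim ?N = enat (cvs.dim ?N)" unfolding cdim_def by auto
  show ?thesis
  proof (cases "\<exists>B. finite_quotient_basis V (S ` V) B")
    case True
    define B where "B = (SOME B. finite_quotient_basis V (S ` V) B)"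
    have "finite_quotient_basis V (S ` V) B" unfolding B_def using True by (rule someI_ex)
    then have B: "finite B" "B \<subseteq> V" "\<And>v. v \<in> V \<Longrightarrow> \<exists>c. v - (\<Sum>b\<in>B. c b *\<^sub>C b) \<in> S ` V"
      by (auto simp: finite_quotient_basis_def)
    have N_sub: "cvs.subspace ?N"
      using V(1) by (auto simp: cvs.subspace_def kernel_on_def S.zero S.add bounded_clinearD(2)[OF S])
    obtain E where E: "E \<subseteq> ?N" "cvs.independent E" "?N \<subseteq> cvs.span E" "card E = cvs.dim ?N"
      using cvs.basis_exists by blast
    have "finite E" using cvs.independent_span_bound[OF G(1) E(2)] E(1) G(2) by blast
    moreover have "cvs.span E = ?N" using E(1,3) N_sub cvs.span_minimal by blast
    ultimately have "card E \<le> card B"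
      using card_kernel_basis_le[OF S V SV B _ E(2) _ inj] by blast
    then show ?thesis
      using True by (simp add: index_on_def codim_def dimN B_def[symmetric] E(4))
  next
    case False
    then show ?thesis by (simp add: index_on_def codim_def dimN)
  qed
qed

lemma bounded_clinear_shift: "bounded_clinear T \<Longrightarrow> bounded_clinear (shift T l)"
  unfolding bounded_clinear_def shift_def
  by (auto intro!: bounded_linear_sub bounded_linear_scaleC_right
      simp: cvs.scale_right_diff_distrib mult.commute)

lemma subspace_range_funpow:
  assumes "bounded_clinear S"
  shows "cvs.subspace (range (S ^^ n))"
proof -
  interpret S: bounded_linear S by (rule bounded_clinearD[OF assms])
  have zero: "(S ^^ n) 0 = 0"
    by (induction n) (simp_all add: S.zero)
  have add: "(S ^^ n) (x + y) = (S ^^ n) x + (S ^^ n) y" for x y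
    by (induction n) (simp_all add: S.add)
  have scale: "(S ^^ n) (c *\<^sub>C x) = c *\<^sub>C (S ^^ n) x" for c x
    by (induction n) (simp_all add: bounded_clinearD(2)[OF assms])
  show ?thesis
  proof (rule cvs.subspaceI)
    show "0 \<in> range (S ^^ n)" using rangeI[of "S ^^ n" 0] by (simp only: zero)
  qed (auto simp flip: add scale)
qed

text \<open>
  Outside the approximate point spectrum \<open>\<mu> = 0\<close> will do; at an isolated point of the spectrum
  a small \<open>\<mu> \<noteq> 0\<close> leads to a point of the resolvent set.
\<close>

lemma injective_shifts_nearby:
  assumes T: "bounded_clinear T"
    and l: "l \<notin> approx_point_spectrum T \<or> l \<in> iso (spectrum T)" and \<epsilon>: "\<epsilon> > 0"
  shows "\<exists>\<mu>. cmod \<mu> < \<epsilon> \<and> (\<forall>x. shift T l x = \<mu> *\<^sub>C x \<longrightarrow> x = 0)"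
  using l
proof
  assume l: "l \<notin> approx_point_spectrum T"
  have "x = 0" if x: "shift T l x = 0" for x
  proof (rule ccontr)
    assume "x \<noteq> 0"
    define u where "u = (1 / complex_of_real (norm x)) *\<^sub>C x"
    have "norm u = 1" using \<open>x \<noteq> 0\<close> by (simp add: u_def norm_scaleC norm_divide)
    moreover have "shift T l u = 0"
      unfolding u_def bounded_clinearD(2)[OF bounded_clinear_shift[OF T]] x by simp
    ultimately have "l \<in> approx_point_spectrum T"
      unfolding approx_point_spectrum_def by (auto intro!: exI[of _ "\<lambda>_. u"])
    with l show False ..
  qed
  then show ?thesis using \<epsilon> by (intro exI[of _ 0]) simp
next
  assume "l \<in> iso (spectrum T)"
  then obtain \<delta> where \<delta>: "\<delta> > 0" "\<And>y. y \<in> spectrum T \<Longrightarrow> dist l y < \<delta> \<Longrightarrow> y = l"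
    unfolding iso_def by (auto elim: isolated_inE_dist)
  define \<mu> where "\<mu> = complex_of_real (min \<epsilon> \<delta> / 2)"
  have \<mu>: "cmod \<mu> < \<epsilon>" "cmod \<mu> < \<delta>" "\<mu> \<noteq> 0"
    using \<epsilon> \<delta>(1) by (auto simp: \<mu>_def simp del: of_real_divide)
  then have "l + \<mu> \<notin> spectrum T" using \<delta>(2)[of "l + \<mu>"] by (auto simp: dist_norm)
  then obtain R where R: "R \<circ> shift T (l + \<mu>) = id" "bounded_clinear R"
    unfolding spectrum_def by blast
  interpret R: bounded_linear R by (rule bounded_clinearD[OF R(2)])
  have "x = 0" if "shift T l x = \<mu> *\<^sub>C x" for x
  proof -
    have "shift T (l + \<mu>) x = 0" using that by (simp add: shift_def scaleC_add_left algebra_simps)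
    then show ?thesis using fun_cong[OF R(1), of x] by (simp add: R.zero)
  qed
  then show ?thesis using \<mu>(1) by blast
qed

lemma upper_semi_Fredholm_imp_Weyl:
  assumes T: "bounded_clinear T" and l: "l \<notin> approx_point_spectrum T \<or> l \<in> iso (spectrum T)"
    and F: "upper_semi_Fredholm (shift T l)"
  shows "upper_semi_Weyl (shift T l)"
proof -
  have "index_on UNIV (shift T l) \<le> 0"
    using F injective_shifts_nearby[OF T l]
    by (intro index_on_nonpos bounded_clinear_shift T)
      (auto simp: upper_semi_Fredholm_def upper_semi_Fredholm_on_def)
  with F show ?thesis by (simp add: upper_semi_Weyl_def)
qed

text \<open>
  The range of \<open>S\<^sup>n\<close>, for the exponent \<open>n\<close> that defines the B-index, is a closed invariant subspace,
  and injectivity of the nearby shifts is inherited by it.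
\<close>

lemma upper_semi_B_Fredholm_imp_Weyl:
  assumes T: "bounded_clinear T" and l: "l \<notin> approx_point_spectrum T \<or> l \<in> iso (spectrum T)"
    and F: "upper_semi_B_Fredholm (shift T l)"
  shows "upper_semi_B_Weyl (shift T l)"
proof -
  let ?S = "shift T l"
  have S: "bounded_clinear ?S" by (rule bounded_clinear_shift[OF T])
  define n where "n = (SOME n. B_Fredholm_exponent ?S n)"
  have "B_Fredholm_exponent ?S n"
    unfolding n_def using F by (auto simp: upper_semi_B_Fredholm_def intro: someI_ex)
  then have n: "closed (range (?S ^^ n))" "cdim (kernel_on (range (?S ^^ n)) ?S) < \<infinity>"
    by (auto simp: B_Fredholm_exponent_def upper_semi_Fredholm_on_def)
  have "?S ` range (?S ^^ n) \<subseteq> range (?S ^^ n)"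
    by (auto simp: funpow_swap1)
  moreover have "\<exists>\<mu>. cmod \<mu> < \<epsilon> \<and> (\<forall>x\<in>range (?S ^^ n). ?S x = \<mu> *\<^sub>C x \<longrightarrow> x = 0)"
    if "\<epsilon> > 0" for \<epsilon>
    using injective_shifts_nearby[OF T l that] by metis
  ultimately have "index_on (range (?S ^^ n)) ?S \<le> 0"
    by (rule index_on_nonpos[OF S subspace_range_funpow[OF S] n(1) _ n(2)])
  then show ?thesis
    using F by (simp add: upper_semi_B_Weyl_def B_index_def n_def)
qed

theorem theorem4p3:
  fixes T :: "'a :: complex_banach \<Rightarrow> 'a"
  assumes "bounded_clinear T"
  shows "(property_w_pi00 T \<longleftrightarrow> property_w T \<and> sigma_uf T = sigma_uw T) \<and>
         (property_gw_pi00 T \<longleftrightarrow> property_gw T \<and> sigma_ubf T = sigma_ubw T)"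
proof (intro conjI)
  have "sigma_uf T = sigma_uw T" if "property_w_pi00 T"
  proof -
    have "l \<notin> approx_point_spectrum T \<or> l \<in> iso (spectrum T)" if "l \<notin> sigma_uf T" for l
      using \<open>property_w_pi00 T\<close> that unfolding property_w_pi00_def pi_00_def by blast
    then show ?thesis
      using upper_semi_Fredholm_imp_Weyl[OF assms]
      by (auto simp: sigma_uf_def sigma_uw_def upper_semi_Weyl_def)
  qed
  then show "property_w_pi00 T \<longleftrightarrow> property_w T \<and> sigma_uf T = sigma_uw T"
    by (auto simp: property_w_def property_w_pi00_def)
next
  have "sigma_ubf T = sigma_ubw T" if "property_gw_pi00 T"
  proof -
    have "l \<notin> approx_point_spectrum T \<or> l \<in> iso (spectrum T)" if "l \<notin> sigma_ubf T" for l
      using \<open>property_gw_pi00 T\<close> that unfolding property_gw_pi00_def pi_0_def by blast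
    then show ?thesis
      using upper_semi_B_Fredholm_imp_Weyl[OF assms]
      by (auto simp: sigma_ubf_def sigma_ubw_def upper_semi_B_Weyl_def)
  qed
  then show "property_gw_pi00 T \<longleftrightarrow> property_gw T \<and> sigma_ubf T = sigma_ubw T"
    by (auto simp: property_gw_def property_gw_pi00_def)
qed

end
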